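(* Let $n\ge 2$ and let $G$ be a connected weighted graph on the node set $V=\{1,\dots,n\}$ with weighted Laplacian $L$ and Moore–Penrose pseudoinverse $L^+$. Let $\mu\in\mathbb{R}^n$ satisfy $\mathbf 1^T\mu=0$, and let $\omega$ be a random vector in $\mathbb{R}^n$ with mean zero, finite second moments, covariance matrix $\Sigma$, and $\sigma^2:=\mathbf 1^T\Sigma\mathbf 1>0$. For $1\le k\le n$ let $$\mathcal B_k:=\Big\{\tfrac1k\sum_{i\in B}\mathbf e_i \,:\, B\subseteq V,\ |B|=k\Big\},\qquad \mathcal H_k:=\frac1{|\mathcal B_k|}\sum_{\alpha\in\mathcal B_k}\mathbb{E}\,\mathcal H_s(\alpha),$$ where $\mathbf e_i$ is the $i$-th standard basis vector of $\mathbb{R}^n$. Then for every $1\le k\le n$, $$\mathcal H_k=C_1+\frac{C_2}{k},$$ where the constants $$C_1:=\frac12\operatorname{tr}(\Sigma L^+)-\sigma^2\frac{\operatorname{tr}(L^+)}{2n(n-1)},\qquad C_2:=\sigma^2\frac{\operatorname{tr}(L^+)}{2(n-1)}$$ do not depend on $k$.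
   Context: Weighted graph: simple undirected graph on $V=\{1,\dots,n\}$ with symmetric edge weights $\beta_{i,j}=\beta_{j,i}\ge 0$ ($i\ne j$); a missing edge is the same as an edge of weight $0$, and connectedness refers to the edges of positive weight. The weighted Laplacian is $L_{i,i}=\sum_{j\ne i}\beta_{i,j}$, $L_{i,j}=-\beta_{i,j}$ for $i\neq j$. Its Moore–Penrose pseudoinverse is $L^+=(L+\frac1n\mathbf 1\mathbf 1^T)^{-1}-\frac1n\mathbf 1\mathbf 1^T$. $\mathbf 1$ denotes the all-ones vector in $\mathbb{R}^n$. $\Sigma_{i,j}=\mathbb{E}[\omega_i\omega_j]$; $\sigma^2=\mathbf 1^T\Sigma\mathbf 1$ is the variance of $\sum_i\omega_i$. For $\alpha\in\mathbb{R}^n$ put $C_\alpha:=I-\alpha\mathbf 1^T$, $p(\alpha):=C_\alpha(\mu+\omega)=\mu+C_\alpha\omega$ (the net load profile), $\mathcal H(\alpha):=\frac12p(\alpha)^TL^+p(\alpha)$ (total loss), and $\mathcal H_s(\alpha):=\mathcal H(\alpha)-\frac12\mu^TL^+\mu$ (total loss due to fluctuations). Thus $\mathcal H_k$ is the expected loss due to fluctuations when $k$ controllable nodes share the load equally, averaged over all $\binom nk$ locations of these nodes. *)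

theory Defs
  imports "HOL-Probability.Probability"
begin

text \<open>The node set is a finite index type \<open>'n\<close>, so that \<open>n = CARD('n)\<close>. The diagonal entries of an
  edge weight function \<open>\<beta>\<close> are never looked at.\<close>

definition weighted_graph :: "('n::finite \<Rightarrow> 'n \<Rightarrow> real) \<Rightarrow> bool" where
  "weighted_graph \<beta> \<longleftrightarrow> (\<forall>i j. i \<noteq> j \<longrightarrow> \<beta> i j = \<beta> j i \<and> \<beta> i j \<ge> 0)"

definition edges :: "('n::finite \<Rightarrow> 'n \<Rightarrow> real) \<Rightarrow> ('n \<times> 'n) set" where
  "edges \<beta> = {(i, j). i \<noteq> j \<and> \<beta> i j > 0}"

definition connected_graph :: "('n::finite \<Rightarrow> 'n \<Rightarrow> real) \<Rightarrow> bool" where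
  "connected_graph \<beta> \<longleftrightarrow> (\<forall>i j. (i, j) \<in> (edges \<beta>)\<^sup>*)"

definition laplacian :: "('n::finite \<Rightarrow> 'n \<Rightarrow> real) \<Rightarrow> real^'n^'n" where
  "laplacian \<beta> = (\<chi> i j. if i = j then \<Sum>k\<in>UNIV - {i}. \<beta> i k else - \<beta> i j)"

definition outer :: "real^'n::finite \<Rightarrow> real^'n \<Rightarrow> real^'n^'n" where
  "outer u v = (\<chi> i j. u $ i * v $ j)"

definition avg_matrix :: "real^'n::finite^'n" where
  "avg_matrix = (1 / real CARD('n)) *\<^sub>R outer 1 1"

text \<open>For a connected graph this is the Moore--Penrose pseudoinverse of the Laplacian; see
  \<open>is_pinv_laplacian_pinv\<close> below.\<close>

definition laplacian_pinv :: "('n::finite \<Rightarrow> 'n \<Rightarrow> real) \<Rightarrow> real^'n^'n" where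
  "laplacian_pinv \<beta> = matrix_inv (laplacian \<beta> + avg_matrix) - avg_matrix"

definition second_moments :: "'a measure \<Rightarrow> ('a \<Rightarrow> real^'n::finite) \<Rightarrow> real^'n^'n" where
  "second_moments M \<omega> = (\<chi> i j. \<integral>x. \<omega> x $ i * \<omega> x $ j \<partial>M)"

definition share_matrix :: "real^'n::finite \<Rightarrow> real^'n^'n" where
  "share_matrix \<alpha> = mat 1 - outer \<alpha> 1"

definition net_load :: "real^'n::finite \<Rightarrow> real^'n \<Rightarrow> real^'n \<Rightarrow> real^'n" where
  "net_load \<mu> w \<alpha> = share_matrix \<alpha> *v (\<mu> + w)"

definition total_loss :: "('n::finite \<Rightarrow> 'n \<Rightarrow> real) \<Rightarrow> real^'n \<Rightarrow> real^'n \<Rightarrow> real^'n \<Rightarrow> real" where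
  "total_loss \<beta> \<mu> w \<alpha> =
     1/2 * (net_load \<mu> w \<alpha> \<bullet> (laplacian_pinv \<beta> *v net_load \<mu> w \<alpha>))"

definition fluct_loss :: "('n::finite \<Rightarrow> 'n \<Rightarrow> real) \<Rightarrow> real^'n \<Rightarrow> real^'n \<Rightarrow> real^'n \<Rightarrow> real" where
  "fluct_loss \<beta> \<mu> w \<alpha> = total_loss \<beta> \<mu> w \<alpha> - 1/2 * (\<mu> \<bullet> (laplacian_pinv \<beta> *v \<mu>))"

definition equal_shares :: "nat \<Rightarrow> (real^'n::finite) set" where
  "equal_shares k = {(1 / real k) *\<^sub>R (\<Sum>i\<in>B. axis i 1) | B. card B = k}"

definition mean_fluct_loss ::
  "('n::finite \<Rightarrow> 'n \<Rightarrow> real) \<Rightarrow> real^'n \<Rightarrow> 'a measure \<Rightarrow> ('a \<Rightarrow> real^'n) \<Rightarrow> nat \<Rightarrow> real" where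
  "mean_fluct_loss \<beta> \<mu> M \<omega> k =
     1 / real (card (equal_shares k :: (real^'n) set)) *
     (\<Sum>\<alpha>\<in>equal_shares k. \<integral>x. fluct_loss \<beta> \<mu> (\<omega> x) \<alpha> \<partial>M)"


text \<open>The four Penrose conditions.\<close>

definition is_pinv :: "real^'n::finite^'n \<Rightarrow> real^'n^'n \<Rightarrow> bool" where
  "is_pinv A X \<longleftrightarrow> A ** X ** A = A \<and> X ** A ** X = X \<and>
     transpose (A ** X) = A ** X \<and> transpose (X ** A) = X ** A"

lemma laplacian_mult_component:
  "(laplacian \<beta> *v x) $ i = (\<Sum>j\<in>UNIV - {i}. \<beta> i j * (x $ i - x $ j))"
proof -
  have "(laplacian \<beta> *v x) $ i = (\<Sum>j\<in>UNIV. laplacian \<beta> $ i $ j * x $ j)"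
    by (simp add: matrix_vector_mult_def)
  also have "\<dots> = laplacian \<beta> $ i $ i * x $ i + (\<Sum>j\<in>UNIV - {i}. laplacian \<beta> $ i $ j * x $ j)"
    by (rule sum.remove) auto
  also have "(\<Sum>j\<in>UNIV - {i}. laplacian \<beta> $ i $ j * x $ j) = (\<Sum>j\<in>UNIV - {i}. - \<beta> i j * x $ j)"
    by (rule sum.cong) (auto simp: laplacian_def)
  finally show ?thesis
    by (simp add: laplacian_def sum_distrib_right right_diff_distrib sum_subtractf sum_negf)
qed

lemma laplacian_quadratic_form:
  assumes "weighted_graph \<beta>"
  shows "x \<bullet> (laplacian \<beta> *v x) =
    1/2 * (\<Sum>i\<in>UNIV. \<Sum>j\<in>UNIV - {i}. \<beta> i j * (x $ i - x $ j)\<^sup>2)"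
proof -
  define w where "w i j = (if i = j then 0 else \<beta> i j)" for i j
  have w_sym: "w i j = w j i" for i j
    using assms by (auto simp: w_def weighted_graph_def)
  have w_sum: "(\<Sum>j\<in>UNIV - {i}. \<beta> i j * f j) = (\<Sum>j\<in>UNIV. w i j * f j)" for i and f :: "'a \<Rightarrow> real"
    by (simp add: sum.remove[of UNIV i] w_def)
  have "x \<bullet> (laplacian \<beta> *v x) = (\<Sum>i\<in>UNIV. \<Sum>j\<in>UNIV. w i j * (x $ i * (x $ i - x $ j)))"
    (is "_ = ?S")
    by (simp add: inner_vec_def laplacian_mult_component w_sum sum_distrib_left mult_ac)
  moreover have "?S = (\<Sum>i\<in>UNIV. \<Sum>j\<in>UNIV. w i j * (x $ j * (x $ j - x $ i)))"
    by (subst sum.swap) (simp add: w_sym)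
  ultimately have "2 * (x \<bullet> (laplacian \<beta> *v x)) =
      ?S + (\<Sum>i\<in>UNIV. \<Sum>j\<in>UNIV. w i j * (x $ j * (x $ j - x $ i)))"
    by linarith
  also have "\<dots> = (\<Sum>i\<in>UNIV. \<Sum>j\<in>UNIV. w i j * (x $ i - x $ j)\<^sup>2)"
    by (simp add: sum.distrib[symmetric] power2_eq_square algebra_simps)
  finally show ?thesis by (simp add: w_sum)
qed

lemma laplacian_kernel:
  assumes g: "weighted_graph \<beta>" and c: "connected_graph \<beta>" and x: "laplacian \<beta> *v x = 0"
  shows "x $ i = x $ j"
proof -
  have nonneg: "0 \<le> \<beta> i j * (x $ i - x $ j)\<^sup>2" if "j \<in> UNIV - {i}" for i j
    using g that by (auto simp: weighted_graph_def)
  have "(\<Sum>i\<in>UNIV. \<Sum>j\<in>UNIV - {i}. \<beta> i j * (x $ i - x $ j)\<^sup>2) = 0"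
    using laplacian_quadratic_form[OF g, of x] x by simp
  then have "(\<Sum>j\<in>UNIV - {i}. \<beta> i j * (x $ i - x $ j)\<^sup>2) = 0" for i
    by (subst (asm) sum_nonneg_eq_0_iff) (auto intro!: sum_nonneg nonneg)
  then have zero: "\<beta> i j * (x $ i - x $ j)\<^sup>2 = 0" if "i \<noteq> j" for i j
    using that by (subst (asm) sum_nonneg_eq_0_iff) (auto intro!: nonneg)
  have edge: "x $ i = x $ j" if "(i, j) \<in> edges \<beta>" for i j
    using zero[of i j] that by (auto simp: edges_def)
  have "(i, j) \<in> (edges \<beta>)\<^sup>*" using c by (simp add: connected_graph_def)
  then show ?thesis by (induction rule: rtrancl_induct) (auto dest: edge)
qed

lemma transpose_laplacian:
  assumes "weighted_graph \<beta>"
  shows "transpose (laplacian \<beta>) = laplacian \<beta>"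
  using assms by (auto simp: vec_eq_iff transpose_def laplacian_def weighted_graph_def)

lemma transpose_avg_matrix: "transpose avg_matrix = avg_matrix"
  by (simp add: vec_eq_iff transpose_def avg_matrix_def outer_def)

lemma avg_matrix_idem: "(avg_matrix :: real^'n::finite^'n) ** avg_matrix = avg_matrix"
  by (simp add: vec_eq_iff matrix_matrix_mult_def avg_matrix_def outer_def)

lemma laplacian_avg_matrix: "laplacian \<beta> ** (avg_matrix :: real^'n::finite^'n) = 0"
proof -
  have "laplacian \<beta> *v (\<chi> i. 1 / real CARD('n)) = 0"
    by (simp add: vec_eq_iff laplacian_mult_component)
  then show ?thesis
    by (simp add: vec_eq_iff matrix_matrix_mult_def matrix_vector_mult_def avg_matrix_def outer_def)
qed

lemma avg_matrix_laplacian: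
  assumes "weighted_graph \<beta>"
  shows "(avg_matrix :: real^'n::finite^'n) ** laplacian \<beta> = 0"
proof -
  have "transpose (avg_matrix ** laplacian \<beta>) = 0"
    by (simp add: matrix_transpose_mul transpose_laplacian[OF assms] transpose_avg_matrix
        laplacian_avg_matrix)
  then have "transpose (transpose (avg_matrix ** laplacian \<beta>)) = 0"
    by (simp add: vec_eq_iff transpose_def)
  then show ?thesis by simp
qed

lemma invertible_laplacian_avg:
  fixes \<beta> :: "'n::finite \<Rightarrow> 'n \<Rightarrow> real"
  assumes g: "weighted_graph \<beta>" and c: "connected_graph \<beta>"
  shows "invertible (laplacian \<beta> + avg_matrix)"
proof -
  have "x = 0" if x: "(laplacian \<beta> + avg_matrix) *v x = 0" for x :: "real^'n"
  proof -
    have "avg_matrix *v ((laplacian \<beta> + avg_matrix) *v x) = avg_matrix *v x"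
      by (simp add: matrix_vector_mul_assoc matrix_add_ldistrib avg_matrix_laplacian[OF g]
          avg_matrix_idem)
    then have J: "avg_matrix *v x = 0" using x by simp
    then have "laplacian \<beta> *v x = 0" using x by (simp add: matrix_vector_mult_add_rdistrib)
    then have const: "x $ i = x $ j" for i j by (rule laplacian_kernel[OF g c])
    have "x $ i = 0" for i
    proof -
      have "(avg_matrix *v x) $ i = (\<Sum>j\<in>UNIV. x $ j / real CARD('n))"
        by (simp add: matrix_vector_mult_def avg_matrix_def outer_def)
      also have "\<dots> = (\<Sum>j\<in>(UNIV :: 'n set). x $ i / real CARD('n))"
        by (intro sum.cong refl) (metis const)
      finally show ?thesis using J by simp
    qed
    then show ?thesis by (simp add: vec_eq_iff)
  qed
  then show ?thesis
    by (auto simp: invertible_left_inverse matrix_left_invertible_ker)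
qed

lemma is_pinv_laplacian_pinv:
  fixes \<beta> :: "'n::finite \<Rightarrow> 'n \<Rightarrow> real"
  assumes g: "weighted_graph \<beta>" and c: "connected_graph \<beta>"
  shows "is_pinv (laplacian \<beta>) (laplacian_pinv \<beta>)"
proof -
  define L where "L = laplacian \<beta>"
  define J :: "real^'n^'n" where "J = avg_matrix"
  define K where "K = matrix_inv (L + J)"
  have add_r: "(A + B) ** C = A ** C + B ** C" for A B C :: "real^'n^'n"
    by (simp add: vec_eq_iff matrix_matrix_mult_def distrib_right sum.distrib)
  have diff_l: "A ** (B - C) = A ** B - A ** C" for A B C :: "real^'n^'n"
    by (simp add: vec_eq_iff matrix_matrix_mult_def right_diff_distrib sum_subtractf)
  have diff_r: "(A - B) ** C = A ** C - B ** C" for A B C :: "real^'n^'n"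
    by (simp add: vec_eq_iff matrix_matrix_mult_def left_diff_distrib sum_subtractf)
  have "\<exists>A'. (L + J) ** A' = mat 1 \<and> A' ** (L + J) = mat 1"
    using invertible_laplacian_avg[OF g c] by (simp add: invertible_def L_def J_def)
  then have inv: "(L + J) ** K = mat 1" "K ** (L + J) = mat 1"
    unfolding K_def matrix_inv_def by (metis (mono_tags, lifting) someI_ex)+
  have LJ: "L ** J = 0" and JL: "J ** L = 0" and JJ: "J ** J = J"
    by (simp_all add: L_def J_def laplacian_avg_matrix avg_matrix_laplacian[OF g] avg_matrix_idem)
  have KJ: "K ** J = J"
  proof -
    have "K ** J = K ** ((L + J) ** J)" by (simp add: add_r LJ JJ)
    also have "\<dots> = J" by (simp add: matrix_mul_assoc inv)
    finally show ?thesis .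
  qed
  have JK: "J ** K = J"
  proof -
    have "J ** K = (J ** (L + J)) ** K" by (simp add: matrix_add_ldistrib JL JJ)
    also have "\<dots> = J" by (simp add: matrix_mul_assoc[symmetric] inv)
    finally show ?thesis .
  qed
  have X: "laplacian_pinv \<beta> = K - J" by (simp add: laplacian_pinv_def K_def L_def J_def)
  have LX: "L ** (K - J) = mat 1 - J"
    using inv(1) by (simp add: diff_l LJ add_r JK eq_diff_eq)
  have XL: "(K - J) ** L = mat 1 - J"
    using inv(2) by (simp add: diff_r JL matrix_add_ldistrib KJ eq_diff_eq)
  have sym: "transpose (mat 1 - J) = mat 1 - J"
    using transpose_avg_matrix[where 'a='n]
    by (simp add: J_def vec_eq_iff transpose_def mat_def)
  have "(mat 1 - J) ** L = L" by (simp add: diff_r JL)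
  moreover have "(mat 1 - J) ** (K - J) = K - J" by (simp add: diff_r diff_l JK JJ)
  ultimately show ?thesis
    by (simp add: is_pinv_def X LX XL sym flip: L_def)
qed

end

theory Submission
  imports Defs
begin

text \<open>Expanding the loss around \<open>\<mu>\<close> leaves, after taking expectations, the constant
  \<open>tr(\<Sigma> L\<^sup>+) / 2\<close>, a term that is linear in \<open>\<alpha>\<close>, and \<open>\<sigma>\<^sup>2 \<alpha>\<^sup>T L\<^sup>+ \<alpha> / 2\<close>. Since \<open>L\<^sup>+\<close> has
  vanishing row and column sums and the average of \<open>\<alpha>\<close> is a constant vector, the linear term
  averages to zero. For the quadratic term, vanishing row sums give
  \<open>\<Sum>i\<in>B. \<Sum>j\<in>B. L\<^sup>+\<^sub>i\<^sub>j = - (\<Sum>i\<in>B. \<Sum>j\<notin>B. L\<^sup>+\<^sub>i\<^sub>j)\<close>, and every ordered pair \<open>i \<noteq> j\<close> is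
  separated by the same number of \<open>k\<close>-sets \<open>B\<close>.\<close>

section \<open>Subset counting and kernels of pseudoinverses\<close>

text \<open>Deleting \<open>T\<close> puts these sets in bijection with the subsets of
  \<open>A - T\<close> of size \<open>k - card T\<close>.\<close>

lemma card_supersets_of_card:
  assumes "finite A" "T \<subseteq> A" "card T \<le> k"
  shows "card {B. B \<subseteq> A \<and> card B = k \<and> T \<subseteq> B} = (card A - card T) choose (k - card T)"
proof -
  have fT: "finite T" using assms finite_subset by blast
  have "bij_betw (\<lambda>C. C \<union> T) {C. C \<subseteq> A - T \<and> card C = k - card T}
      {B. B \<subseteq> A \<and> card B = k \<and> T \<subseteq> B}"
  proof (rule bij_betwI[where g = "\<lambda>B. B - T"])
    show "(\<lambda>C. C \<union> T) \<in> {C. C \<subseteq> A - T \<and> card C = k - card T} \<rightarrow>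
        {B. B \<subseteq> A \<and> card B = k \<and> T \<subseteq> B}"
    proof safe
      fix C assume C: "C \<subseteq> A - T" "card C = k - card T"
      then have "finite C" using assms finite_subset by blast
      moreover have "C \<inter> T = {}" using C by blast
      ultimately show "card (C \<union> T) = k"
        using C fT assms by (simp add: card_Un_disjoint)
    qed (use assms in auto)
    show "(\<lambda>B. B - T) \<in> {B. B \<subseteq> A \<and> card B = k \<and> T \<subseteq> B} \<rightarrow>
        {C. C \<subseteq> A - T \<and> card C = k - card T}"
      using fT by (auto simp: card_Diff_subset)
  qed auto
  then have "card {B. B \<subseteq> A \<and> card B = k \<and> T \<subseteq> B} =
      card {C. C \<subseteq> A - T \<and> card C = k - card T}"
    by (simp add: bij_betw_same_card)
  also have "\<dots> = card (A - T) choose (k - card T)"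
    using assms by (simp add: n_subsets)
  finally show ?thesis using assms fT by (simp add: card_Diff_subset)
qed

text \<open>Symmetry of \<open>A ** X\<close> and of \<open>A\<close> gives
  \<open>A ** X = transpose X ** A\<close>, hence \<open>X = X ** transpose X ** A\<close>. Symmetry
  of \<open>X ** A\<close> gives \<open>transpose X = transpose X ** X ** A\<close>. Both products
  end in \<open>A\<close>, so they kill its kernel.\<close>

lemma is_pinv_null_space:
  fixes A X :: "real^'n::finite^'n"
  assumes X: "is_pinv A X" and sym: "transpose A = A" and v: "A *v v = 0"
  shows "X *v v = 0" "transpose X *v v = 0"
proof -
  have "X *v v = (X ** (A ** X)) *v v"
    using X by (simp add: is_pinv_def matrix_mul_assoc)
  also have "\<dots> = (X ** (transpose X ** A)) *v v"
    using X sym by (metis is_pinv_def matrix_transpose_mul)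
  finally show "X *v v = 0"
    using v by (simp add: matrix_mul_assoc flip: matrix_vector_mul_assoc)
  have "transpose X *v v = transpose ((X ** A) ** X) *v v"
    using X by (simp add: is_pinv_def)
  also have "\<dots> = (transpose X ** (X ** A)) *v v"
    using X by (metis is_pinv_def matrix_transpose_mul)
  finally show "transpose X *v v = 0"
    using v by (simp add: matrix_mul_assoc flip: matrix_vector_mul_assoc)
qed

subsection \<open>Averages over equal shares\<close>

text \<open>Naming the map behind \<open>equal_shares\<close> lets sums over load vectors be
  reindexed over \<open>k\<close>-subsets.\<close>

definition equal_share :: "nat \<Rightarrow> 'n::finite set \<Rightarrow> real^'n" where
  "equal_share k B = (1 / real k) *\<^sub>R (\<Sum>i\<in>B. axis i 1)"

lemma equal_share_nth: "equal_share k B $ (i :: _ :: finite) = of_bool (i \<in> B) / real k"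
  by (simp add: equal_share_def axis_def of_bool_def sum.delta)

text \<open>A set is recovered as the support of its share vector.\<close>

lemma bij_betw_equal_share:
  assumes "k > 0"
  shows "bij_betw (equal_share k) {B :: 'n::finite set. card B = k} (equal_shares k)"
proof (rule bij_betw_imageI)
  show "inj_on (equal_share k) {B :: 'n set. card B = k}"
  proof (rule inj_onI)
    fix B C :: "'n set" assume eq: "equal_share k B = equal_share k C"
    have "(i \<in> B) = (i \<in> C)" for i
      using arg_cong[OF eq, of "\<lambda>v. v $ i"] assms unfolding equal_share_nth
      by (simp add: of_bool_def split: if_splits)
    then show "B = C" by blast
  qed
qed (auto simp: equal_shares_def equal_share_def)

text \<open>Each node lies in equally many \<open>k\<close>-subsets and receives
  \<open>1 / k\<close> from each of them.\<close>

lemma equal_shares_sum_id: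
  assumes "k > 0"
  shows "(\<Sum>\<alpha>\<in>equal_shares k. \<alpha>) =
    (real ((CARD('n) - 1) choose (k - 1)) / real k) *\<^sub>R (1 :: real^'n::finite)"
proof -
  have "(\<Sum>\<alpha>\<in>equal_shares k. \<alpha>) $ i = real ((CARD('n) - 1) choose (k - 1)) / real k" for i :: 'n
  proof -
    have "{B :: 'n set. card B = k} \<inter> {B. i \<in> B} = {B. B \<subseteq> UNIV \<and> card B = k \<and> {i} \<subseteq> B}"
      by auto
    then have "card ({B :: 'n set. card B = k} \<inter> {B. i \<in> B}) = (CARD('n) - 1) choose (k - 1)"
      using card_supersets_of_card[of "UNIV :: 'n set" "{i}" k] assms by simp
    then show ?thesis
      by (simp only: sum_component equal_share_nth
          flip: sum_divide_distrib sum.reindex_bij_betw[OF bij_betw_equal_share[OF assms]])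
        (simp add: of_bool_def sum.If_cases)
  qed
  then show ?thesis by (simp add: vec_eq_iff)
qed

lemma sum_subsets_quadratic_form:
  fixes A :: "real^'n::finite^'n"
  assumes rows: "A *v 1 = 0" and k: "k > 0"
  shows "(\<Sum>B | card B = k. \<Sum>i\<in>B. \<Sum>j\<in>B. A $ i $ j) =
    real ((CARD('n) - 2) choose (k - 1)) * trace A"
proof -
  define c where "c = real ((CARD('n) - 2) choose (k - 1))"
  have row: "(\<Sum>j\<in>UNIV. A $ i $ j) = 0" for i
    using rows by (simp add: vec_eq_iff matrix_vector_mult_def)
  \<comment> \<open>For \<open>i \<noteq> j\<close> these are the \<open>k\<close>-subsets of
    \<open>UNIV - {j}\<close> containing \<open>i\<close>: of the remaining
    \<open>CARD('n) - 2\<close> nodes, \<open>k - 1\<close> are free to choose.\<close>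
  have separating: "(\<Sum>B | card B = k. of_bool (i \<in> B \<and> j \<notin> B)) = (if i = j then 0 else c)"
    for i j :: 'n
  proof -
    have "{B :: 'n set. card B = k} \<inter> {B. i \<in> B \<and> j \<notin> B} =
        {B. B \<subseteq> UNIV - {j} \<and> card B = k \<and> {i} \<subseteq> B}" by auto
    then have "i \<noteq> j \<Longrightarrow> card ({B :: 'n set. card B = k} \<inter> {B. i \<in> B \<and> j \<notin> B}) =
        (CARD('n) - 2) choose (k - 1)"
      using card_supersets_of_card[of "UNIV - {j}" "{i}" k] k
      by (simp add: card_Diff_subset numeral_2_eq_2)
    then show ?thesis by (auto simp: of_bool_def sum.If_cases c_def)
  qed
  have "(\<Sum>i\<in>B. \<Sum>j\<in>B. A $ i $ j) = - (\<Sum>i\<in>B. \<Sum>j\<in>-B. A $ i $ j)" for B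
  proof -
    have "(\<Sum>j\<in>B. A $ i $ j) = - (\<Sum>j\<in>-B. A $ i $ j)" for i
      using row[of i] sum.union_disjoint[of B "-B" "\<lambda>j. A $ i $ j"] by simp
    then have "(\<Sum>i\<in>B. \<Sum>j\<in>B. A $ i $ j) = (\<Sum>i\<in>B. - (\<Sum>j\<in>-B. A $ i $ j))"
      by (intro sum.cong refl)
    then show ?thesis by (simp only: sum_negf)
  qed
  then have "(\<Sum>B | card B = k. \<Sum>i\<in>B. \<Sum>j\<in>B. A $ i $ j) =
      - (\<Sum>B | card B = k. \<Sum>i\<in>B. \<Sum>j\<in>-B. A $ i $ j)"
    by (simp only: sum_negf)
  also have "(\<Sum>B | card B = k. \<Sum>i\<in>B. \<Sum>j\<in>-B. A $ i $ j) =
      (\<Sum>B | card B = k. \<Sum>i\<in>UNIV. \<Sum>j\<in>UNIV. A $ i $ j * of_bool (i \<in> B \<and> j \<notin> B))"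
  proof (rule sum.cong[OF refl])
    fix B :: "'n set"
    have "(\<Sum>j\<in>UNIV. A $ i $ j * of_bool (i \<in> B \<and> j \<notin> B)) =
        (if i \<in> B then \<Sum>j\<in>-B. A $ i $ j else 0)" for i
      by (auto simp: of_bool_def if_distrib sum.If_cases Compl_eq cong: if_cong)
    then show "(\<Sum>i\<in>B. \<Sum>j\<in>-B. A $ i $ j) =
        (\<Sum>i\<in>UNIV. \<Sum>j\<in>UNIV. A $ i $ j * of_bool (i \<in> B \<and> j \<notin> B))"
      by (simp add: sum.If_cases)
  qed
  also have "\<dots> = (\<Sum>i\<in>UNIV. \<Sum>j\<in>UNIV. A $ i $ j *
      (\<Sum>B | card B = k. of_bool (i \<in> B \<and> j \<notin> B)))"
    by (subst sum.swap, rule sum.cong[OF refl], subst sum.swap) (simp only: sum_distrib_left)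
  \<comment> \<open>The off-diagonal sum is the full sum minus the diagonal. The full sum vanishes
    by \<open>row\<close>, which leaves minus the trace; this sign cancels the one from passing to
    \<open>-B\<close>.\<close>
  also have "\<dots> = (\<Sum>i\<in>UNIV. \<Sum>j\<in>UNIV. c * A $ i $ j - (if j = i then c * A $ i $ j else 0))"
    unfolding separating by (intro sum.cong refl) auto
  also have "\<dots> = - c * trace A"
    by (simp add: sum_subtractf row trace_def sum_negf flip: sum_distrib_left)
  finally show ?thesis by (simp add: c_def)
qed

text \<open>The ratio of the separating count to the number of \<open>k\<close>-subsets is
  \<open>k * (n - k) / (n * (n - 1))\<close>. Dividing by the square of \<open>k\<close> leaves
  \<open>(1 / k - 1 / n) / (n - 1)\<close>.\<close>

lemma mean_equal_shares_quadratic_form: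
  fixes A :: "real^'n::finite^'n"
  assumes "A *v 1 = 0" and k: "1 \<le> k" "k \<le> CARD('n)" and n: "CARD('n) \<ge> 2"
  shows "(\<Sum>\<alpha>\<in>equal_shares k. \<alpha> \<bullet> (A *v \<alpha>)) / real (CARD('n) choose k) =
    trace A / (real CARD('n) - 1) * (1 / real k - 1 / real CARD('n))"
proof -
  define n where "n = real CARD('n)"
  define b where "b = real (CARD('n) choose k)"
  define c where "c = real ((CARD('n) - 2) choose (k - 1))"
  have pos: "n > 1" "b > 0" "real k > 0" using k n by (simp_all add: n_def b_def)
  \<comment> \<open>Two absorption identities lead from \<open>n choose k\<close> through
    \<open>(n - 1) choose (k - 1)\<close> to \<open>(n - 2) choose (k - 1)\<close>. They are
    combined over \<open>nat\<close>; \<open>k \<le> CARD('n)\<close> makes the truncated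
    subtraction exact when passing to reals.\<close>
  have "k * (CARD('n) choose k) = CARD('n) * ((CARD('n) - 1) choose (k - 1))"
    using k by (intro times_binomial_minus1_eq) simp
  moreover have "(CARD('n) - k) * ((CARD('n) - 1) choose (k - 1)) =
      (CARD('n) - 1) * ((CARD('n) - 2) choose (k - 1))"
    using binomial_absorb_comp[of "CARD('n) - 1" "k - 1"] k n by (simp add: numeral_2_eq_2)
  ultimately have "CARD('n) * (CARD('n) - 1) * ((CARD('n) - 2) choose (k - 1)) =
      k * (CARD('n) - k) * (CARD('n) choose k)"
    by (metis mult.assoc mult.left_commute)
  from arg_cong[OF this, of real] have c: "n * (n - 1) * c = real k * (n - real k) * b"
    using k n by (simp add: n_def b_def c_def of_nat_diff)
  have form: "equal_share k B \<bullet> (A *v equal_share k B) =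
      (\<Sum>i\<in>B. \<Sum>j\<in>B. A $ i $ j) / (real k)\<^sup>2" for B
  proof -
    \<comment> \<open>The indicators stay explicit while the factors \<open>1 / real k\<close> are
      pulled out; only then do the sums over \<open>UNIV\<close> shrink to sums over
      \<open>B\<close>.\<close>
    have "equal_share k B \<bullet> (A *v equal_share k B) =
        (\<Sum>i\<in>UNIV. of_bool (i \<in> B) * (\<Sum>j\<in>UNIV. of_bool (j \<in> B) * A $ i $ j)) / (real k)\<^sup>2"
      unfolding inner_vec_def matrix_vector_mult_def
      by (simp add: equal_share_nth sum_distrib_left sum_divide_distrib power2_eq_square mult_ac
          del: sum_of_bool_mult_eq sum_mult_of_bool_eq)
    then show ?thesis by simp
  qed
  have "(\<Sum>\<alpha>\<in>equal_shares k. \<alpha> \<bullet> (A *v \<alpha>)) =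
      (\<Sum>B | card B = k. \<Sum>i\<in>B. \<Sum>j\<in>B. A $ i $ j) / (real k)\<^sup>2"
    using pos by (simp only: form sum_divide_distrib of_nat_0_less_iff
        flip: sum.reindex_bij_betw[OF bij_betw_equal_share])
  also have "\<dots> = c * trace A / (real k)\<^sup>2"
    using k assms(1) by (simp add: sum_subsets_quadratic_form c_def)
  also have "c = real k * (n - real k) * b / (n * (n - 1))"
    using c pos by (simp add: field_simps)
  finally show ?thesis
    using pos unfolding n_def[symmetric] b_def[symmetric]
    by (simp add: divide_simps power2_eq_square) (simp add: algebra_simps)
qed

subsection \<open>Expected losses\<close>

text \<open>Since \<open>\<mu>\<close> is balanced, the net load is
  \<open>\<mu> + w - (1 \<bullet> w) *\<^sub>R \<alpha>\<close>, and the term quadratic in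
  \<open>\<mu>\<close> cancels. The rest is grouped into a quadratic form, products of two linear
  forms and one linear form in \<open>w\<close>, ready for termwise integration. Keeping the
  transpose replaces an appeal to symmetry of the pseudoinverse.\<close>

lemma fluct_loss_expand:
  assumes "1 \<bullet> \<mu> = 0"
  shows "fluct_loss \<beta> \<mu> w \<alpha> = 1/2 *
    (w \<bullet> (laplacian_pinv \<beta> *v w)
     - (1 \<bullet> w) * ((laplacian_pinv \<beta> *v \<alpha>) \<bullet> w)
     - (1 \<bullet> w) * ((transpose (laplacian_pinv \<beta>) *v \<alpha>) \<bullet> w)
     + (\<alpha> \<bullet> (laplacian_pinv \<beta> *v \<alpha>)) * ((1 \<bullet> w) * (1 \<bullet> w))
     + (transpose (laplacian_pinv \<beta>) *v \<mu> + laplacian_pinv \<beta> *v \<mu>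
        - (\<mu> \<bullet> (laplacian_pinv \<beta> *v \<alpha>) + \<alpha> \<bullet> (laplacian_pinv \<beta> *v \<mu>)) *\<^sub>R 1) \<bullet> w)"
proof -
  define A where "A = laplacian_pinv \<beta>"
  have outer: "outer \<alpha> 1 *v v = (1 \<bullet> v) *\<^sub>R \<alpha>" for v
    by (simp add: vec_eq_iff matrix_vector_mult_def outer_def inner_vec_def sum_distrib_left mult_ac)
  have net: "net_load \<mu> w \<alpha> = \<mu> + w - (1 \<bullet> w) *\<^sub>R \<alpha>"
    by (simp add: net_load_def share_matrix_def matrix_vector_mult_diff_rdistrib outer
        inner_add_right assms)
  show ?thesis
    unfolding fluct_loss_def total_loss_def net A_def[symmetric]
    by (simp add: dot_lmul_matrix inner_add_left inner_add_right inner_diff_left inner_diff_right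
        matrix_vector_mult_diff_distrib matrix_vector_right_distrib matrix_vector_mult_scaleR
        inner_commute[of w "A *v \<alpha>"] inner_commute[of w "A *v \<mu>"] algebra_simps)
qed

text \<open>Integrability follows by domination: the product is bounded in absolute value by the sum
  of the two squares.\<close>

lemma has_integral_component_mult:
  fixes \<omega> :: "'a \<Rightarrow> real^'n::finite"
  assumes meas: "\<omega> \<in> borel_measurable M"
    and square: "\<And>i. integrable M (\<lambda>x. (\<omega> x $ i)\<^sup>2)"
  shows "has_bochner_integral M (\<lambda>x. \<omega> x $ i * \<omega> x $ j) (second_moments M \<omega> $ i $ j)"
proof -
  have nth: "(\<lambda>x. \<omega> x $ i) \<in> borel_measurable M" for i
    using borel_measurable_inner[OF meas borel_measurable_const[of "axis i 1"]]
    by (simp add: inner_axis)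
  have "integrable M (\<lambda>x. \<omega> x $ i * \<omega> x $ j)"
  proof (rule Bochner_Integration.integrable_bound)
    show "integrable M (\<lambda>x. (\<omega> x $ i)\<^sup>2 + (\<omega> x $ j)\<^sup>2)" using square by simp
    show "AE x in M. norm (\<omega> x $ i * \<omega> x $ j) \<le> norm ((\<omega> x $ i)\<^sup>2 + (\<omega> x $ j)\<^sup>2)"
    proof (rule AE_I2)
      fix x
      have "2 * (\<bar>\<omega> x $ i\<bar> * \<bar>\<omega> x $ j\<bar>) \<le> (\<omega> x $ i)\<^sup>2 + (\<omega> x $ j)\<^sup>2"
        using sum_squares_bound[of "\<bar>\<omega> x $ i\<bar>" "\<bar>\<omega> x $ j\<bar>"] by (simp add: mult_ac)
      moreover have "0 \<le> \<bar>\<omega> x $ i\<bar> * \<bar>\<omega> x $ j\<bar>" by simp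
      ultimately show "norm (\<omega> x $ i * \<omega> x $ j) \<le> norm ((\<omega> x $ i)\<^sup>2 + (\<omega> x $ j)\<^sup>2)"
        unfolding real_norm_def abs_mult by linarith
    qed
  qed (use nth in simp)
  then show ?thesis by (simp add: has_bochner_integral_iff second_moments_def)
qed

text \<open>Termwise integration of the expansion: products of linear forms give bilinear forms in
  the second moments, the quadratic form gives a trace, and the linear form has mean zero.\<close>

lemma expected_fluct_loss:
  fixes \<omega> :: "'a \<Rightarrow> real^'n::finite"
  assumes \<mu>: "1 \<bullet> \<mu> = 0"
    and prob: "prob_space M"
    and meas: "\<omega> \<in> borel_measurable M"
    and square: "\<And>i. integrable M (\<lambda>x. (\<omega> x $ i)\<^sup>2)"
    and mean0: "\<And>i. (\<integral>x. \<omega> x $ i \<partial>M) = 0"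
  shows "(\<integral>x. fluct_loss \<beta> \<mu> (\<omega> x) \<alpha> \<partial>M) = 1/2 *
    (trace (second_moments M \<omega> ** laplacian_pinv \<beta>)
     - 1 \<bullet> (second_moments M \<omega> *v (laplacian_pinv \<beta> *v \<alpha>))
     - 1 \<bullet> (second_moments M \<omega> *v (transpose (laplacian_pinv \<beta>) *v \<alpha>))
     + (\<alpha> \<bullet> (laplacian_pinv \<beta> *v \<alpha>)) * (1 \<bullet> (second_moments M \<omega> *v 1)))"
    (is "_ = 1/2 * ?rhs")
proof -
  interpret prob_space M by (rule prob)
  note moments = has_integral_component_mult[OF meas square]
  have linear: "has_bochner_integral M (\<lambda>x. u \<bullet> \<omega> x) 0" for u
  proof -
    have nth: "(\<lambda>x. \<omega> x $ i) \<in> borel_measurable M" for i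
      using borel_measurable_inner[OF meas borel_measurable_const[of "axis i 1"]]
      by (simp add: inner_axis)
    \<comment> \<open>On a probability space, square integrability implies integrability.\<close>
    have "has_bochner_integral M (\<lambda>x. \<omega> x $ i) 0" for i
      using square_integrable_imp_integrable[OF nth square]
      by (simp add: has_bochner_integral_iff mean0)
    then have "has_bochner_integral M (\<lambda>x. \<Sum>i\<in>UNIV. u $ i * \<omega> x $ i) (\<Sum>i\<in>UNIV. u $ i * 0)"
      by (intro has_bochner_integral_sum has_bochner_integral_mult_right)
    then show ?thesis by (simp add: inner_vec_def)
  qed
  have linear_mult: "has_bochner_integral M (\<lambda>x. (u \<bullet> \<omega> x) * (v \<bullet> \<omega> x))
      (u \<bullet> (second_moments M \<omega> *v v))" for u v
  proof -
    have "has_bochner_integral M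
        (\<lambda>x. \<Sum>i\<in>UNIV. \<Sum>j\<in>UNIV. (u $ i * v $ j) * (\<omega> x $ i * \<omega> x $ j))
        (\<Sum>i\<in>UNIV. \<Sum>j\<in>UNIV. (u $ i * v $ j) * second_moments M \<omega> $ i $ j)"
      by (intro has_bochner_integral_sum has_bochner_integral_mult_right moments)
    then show ?thesis
      unfolding inner_vec_def matrix_vector_mult_def sum_product
      by (simp add: sum_distrib_left mult_ac)
  qed
  have quadratic: "has_bochner_integral M (\<lambda>x. \<omega> x \<bullet> (A *v \<omega> x))
      (trace (second_moments M \<omega> ** A))" for A
  proof -
    have "has_bochner_integral M (\<lambda>x. \<Sum>i\<in>UNIV. \<Sum>j\<in>UNIV. A $ j $ i * (\<omega> x $ i * \<omega> x $ j))
        (\<Sum>i\<in>UNIV. \<Sum>j\<in>UNIV. A $ j $ i * second_moments M \<omega> $ i $ j)"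
      by (intro has_bochner_integral_sum has_bochner_integral_mult_right moments)
    moreover have "\<omega> x \<bullet> (A *v \<omega> x) =
        (\<Sum>i\<in>UNIV. \<Sum>j\<in>UNIV. A $ j $ i * (\<omega> x $ i * \<omega> x $ j))" for x
      unfolding inner_vec_def matrix_vector_mult_def
      by (subst sum.swap) (simp add: sum_distrib_left mult_ac)
    ultimately show ?thesis by (simp add: trace_def matrix_matrix_mult_def mult_ac)
  qed
  \<comment> \<open>The explicit \<open>+ 0\<close> is the integral of the last, linear summand; it
    makes the right-hand side match the shape of the expansion.\<close>
  have "(\<integral>x. fluct_loss \<beta> \<mu> (\<omega> x) \<alpha> \<partial>M) = 1/2 * (?rhs + 0)"
    unfolding fluct_loss_expand[OF \<mu>]
    by (intro has_bochner_integral_integral_eq has_bochner_integral_mult_right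
        has_bochner_integral_add has_bochner_integral_diff quadratic linear_mult linear)
  then show ?thesis by (simp only: add_0_right)
qed

theorem theorem6:
  fixes \<beta> :: "'n::finite \<Rightarrow> 'n \<Rightarrow> real"
    and \<mu> :: "real^'n"
    and M :: "'a measure"
    and \<omega> :: "'a \<Rightarrow> real^'n"
  assumes "CARD('n) \<ge> 2"
    and "weighted_graph \<beta>"
    and "connected_graph \<beta>"
    and "1 \<bullet> \<mu> = 0"
    and "prob_space M"
    and "\<omega> \<in> borel_measurable M"
    and "\<And>i. integrable M (\<lambda>x. (\<omega> x $ i)\<^sup>2)"
    and "\<And>i. (\<integral>x. \<omega> x $ i \<partial>M) = 0"
    and "1 \<bullet> (second_moments M \<omega> *v 1) > 0"
  shows "let n = real CARD('n);
             Lp = laplacian_pinv \<beta>;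
             S = second_moments M \<omega>;
             \<sigma>2 = 1 \<bullet> (S *v 1);
             C1 = 1/2 * trace (S ** Lp) - \<sigma>2 * (trace Lp / (2 * n * (n - 1)));
             C2 = \<sigma>2 * (trace Lp / (2 * (n - 1)))
         in \<forall>k. 1 \<le> k \<and> k \<le> CARD('n) \<longrightarrow>
              mean_fluct_loss \<beta> \<mu> M \<omega> k = C1 + C2 / real k"
proof -
  define A where "A = laplacian_pinv \<beta>"
  define S where "S = second_moments M \<omega>"
  define n where "n = real CARD('n)"
  define \<sigma>2 where "\<sigma>2 = 1 \<bullet> (S *v 1)"
  \<comment> \<open>Constant vectors lie in the kernel of the Laplacian, so the pseudoinverse has
    vanishing row and column sums.\<close>
  have "laplacian \<beta> *v 1 = 0"
    by (simp add: vec_eq_iff laplacian_mult_component)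
  then have A1: "A *v 1 = 0" and A1t: "transpose A *v 1 = 0"
    using is_pinv_null_space[OF is_pinv_laplacian_pinv[OF assms(2,3)]
        transpose_laplacian[OF assms(2)]] by (simp_all add: A_def)
  \<comment> \<open>Separates the dependence on the number of shares, here \<open>x\<close>;
    \<open>m\<close> stands for \<open>n - 1\<close>, \<open>u\<close> for the trace of
    \<open>A\<close> and \<open>s\<close> for \<open>\<sigma>2\<close>.\<close>
  have expand: "1/2 * (t + u / m * (1 / x - 1 / n) * s) =
      (1/2 * t - s * (u / (2 * n * m))) + s * (u / (2 * m)) / x" for t u m x s :: real
    by (simp add: algebra_simps)
  have "mean_fluct_loss \<beta> \<mu> M \<omega> k =
      (1/2 * trace (S ** A) - \<sigma>2 * (trace A / (2 * n * (n - 1))))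
      + \<sigma>2 * (trace A / (2 * (n - 1))) / real k"
    if k: "1 \<le> k" "k \<le> CARD('n)" for k
  proof -
    define b where "b = real (CARD('n) choose k)"
    define Q where "Q = (\<Sum>\<alpha>\<in>equal_shares k. \<alpha> \<bullet> (A *v \<alpha>))"
    have b: "b > 0" using k by (simp add: b_def)
    have card: "real (card (equal_shares k :: (real^'n) set)) = b"
      using bij_betw_same_card[OF bij_betw_equal_share[of k, where 'n = 'n]]
        n_subsets[of "UNIV :: 'n set" k] k by (simp add: b_def)
    \<comment> \<open>By linearity \<open>D\<close> acts on the sum of all share vectors, a multiple
      of \<open>1\<close>. Taking \<open>D\<close> to be \<open>A\<close> and its transpose removes
      both terms linear in \<open>\<alpha>\<close>.\<close>
    have null: "(\<Sum>\<alpha>\<in>equal_shares k. 1 \<bullet> (S *v (D *v \<alpha>))) = 0"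
      if "D *v 1 = 0" for D :: "real^'n^'n"
    proof -
      have "(\<Sum>\<alpha>\<in>equal_shares k. 1 \<bullet> (S *v (D *v \<alpha>))) =
          1 \<bullet> (S *v (D *v (\<Sum>\<alpha>\<in>equal_shares k. \<alpha>)))"
        by (simp add: inner_sum_right linear_sum[OF matrix_vector_mul_linear])
      then show ?thesis
        using k that by (simp add: equal_shares_sum_id matrix_vector_mult_scaleR)
    qed
    have "(\<Sum>\<alpha>\<in>equal_shares k. \<integral>x. fluct_loss \<beta> \<mu> (\<omega> x) \<alpha> \<partial>M) =
        1/2 * (b * trace (S ** A) + Q * \<sigma>2)"
      using null[OF A1] null[OF A1t] card
      by (simp add: expected_fluct_loss[OF assms(4-8)] sum.distrib sum_subtractf Q_def
          \<sigma>2_def sum_distrib_right flip: A_def S_def sum_divide_distrib)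
    then have "mean_fluct_loss \<beta> \<mu> M \<omega> k = 1/2 * (trace (S ** A) + Q / b * \<sigma>2)"
      using b by (simp add: mean_fluct_loss_def card field_simps)
    also have "Q / b = trace A / (n - 1) * (1 / real k - 1 / n)"
      unfolding Q_def b_def n_def
      using mean_equal_shares_quadratic_form[OF A1 k assms(1)] .
    also have "1/2 * (trace (S ** A) + trace A / (n - 1) * (1 / real k - 1 / n) * \<sigma>2) =
        (1/2 * trace (S ** A) - \<sigma>2 * (trace A / (2 * n * (n - 1))))
        + \<sigma>2 * (trace A / (2 * (n - 1))) / real k"
      by (rule expand)
    finally show ?thesis .
  qed
  then show ?thesis
    unfolding Let_def A_def S_def \<sigma>2_def n_def by blast
qed

end
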